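(* (a) The conjugacy class data $(c_\lambda)_{\lambda\in\mathcal{P}(n)}$ of the symmetric group $S_n$ is asymptotically log constant as $n\to\infty$. (b) In the limit as $n\to\infty$, the angle between the vector $(c_\lambda)_{\lambda\in\mathcal{P}(n)}$ and the constant vector $\mathbf{1}=(1,\dots,1)\in\mathbb{R}^{\mathcal{P}(n)}$ is $\pi/2$. In particular, the conjugacy class data is not asymptotically constant.
   Context: $\mathcal{P}(n)$ is the set of integer partitions of $n$, and for $\lambda\in\mathcal{P}(n)$, $c_\lambda$ is the number of elements in the conjugacy class of $S_n$ consisting of permutations of cycle type $\lambda$. Inner products, norms and angles are the standard Euclidean ones. For a sequence of vectors $a^{(n)}\in\mathbb{R}^{\ell_n}$ with $\ell_n\to\infty$, and $\mathbf{1}=(1,\dots,1)\in\mathbb{R}^{\ell_n}$: $a^{(n)}$ is asymptotically constant if $\frac{(a^{(n)},\mathbf{1})}{\|a^{(n)}\|\,\|\mathbf{1}\|}\to 1$ as $n\to\infty$; it is asymptotically log constant if $\frac{\ln(a^{(n)},\mathbf{1})}{\ln(\|a^{(n)}\|\,\|\mathbf{1}\|)}\to 1$ as $n\to\infty$. *)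

theory Defs
  imports "HOL-Analysis.Analysis" "HOL-Combinatorics.Orbits"
begin

section \<open>Vectors indexed by a finite set\<close>

text \<open>
  A vector in \<open>\<real>\<^sup>I\<close>, for a finite set \<open>I\<close>, is a function of which only the values on \<open>I\<close> matter;
  its Euclidean norm is \<^term>\<open>L2_set a I\<close>. Index sets are sets rather than types because they
  vary along a sequence of vectors.
\<close>

definition inner_on :: "'i set \<Rightarrow> ('i \<Rightarrow> real) \<Rightarrow> ('i \<Rightarrow> real) \<Rightarrow> real" where
  "inner_on I a b = (\<Sum>i\<in>I. a i * b i)"

text \<open>Meaningful for nonzero vectors only.\<close>

definition angle_on :: "'i set \<Rightarrow> ('i \<Rightarrow> real) \<Rightarrow> ('i \<Rightarrow> real) \<Rightarrow> real" where
  "angle_on I a b = arccos (inner_on I a b / (L2_set a I * L2_set b I))"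

text \<open>
  The next two notions are meant for sequences of vectors \<open>a n \<in> \<real>\<^bsup>I n\<^esup>\<close> where each \<open>I n\<close> is finite
  and the dimension \<open>card (I n)\<close> tends to infinity. For integer partitions these standing
  assumptions are the lemmas \<open>finite_partitions\<close> and \<open>card_partitions_at_top\<close> below.
\<close>

definition asymptotically_constant :: "(nat \<Rightarrow> 'i set) \<Rightarrow> (nat \<Rightarrow> 'i \<Rightarrow> real) \<Rightarrow> bool" where
  "asymptotically_constant I a \<longleftrightarrow>
     (\<lambda>n. inner_on (I n) (a n) (\<lambda>_. 1) / (L2_set (a n) (I n) * L2_set (\<lambda>_. 1) (I n)))
       \<longlonglongrightarrow> 1"

definition asymptotically_log_constant :: "(nat \<Rightarrow> 'i set) \<Rightarrow> (nat \<Rightarrow> 'i \<Rightarrow> real) \<Rightarrow> bool" where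
  "asymptotically_log_constant I a \<longleftrightarrow>
     (\<lambda>n. ln (inner_on (I n) (a n) (\<lambda>_. 1)) / ln (L2_set (a n) (I n) * L2_set (\<lambda>_. 1) (I n)))
       \<longlonglongrightarrow> 1"

section \<open>Partitions and conjugacy classes of the symmetric group\<close>

definition partitions :: "nat \<Rightarrow> nat multiset set" where
  "partitions n = {L. (\<forall>k\<in>#L. 0 < k) \<and> sum_mset L = n}"

text \<open>
  The multiset of cycle lengths of a permutation of \<open>{1..n}\<close>. The orbits are collected as a set,
  so each cycle contributes once; fixed points contribute parts equal to 1.
\<close>

definition cycle_type :: "nat \<Rightarrow> (nat \<Rightarrow> nat) \<Rightarrow> nat multiset" where
  "cycle_type n p = image_mset card (mset_set (orbit p ` {1..n}))"

definition cycle_type_class :: "nat \<Rightarrow> nat multiset \<Rightarrow> (nat \<Rightarrow> nat) set" where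
  "cycle_type_class n L = {p. p permutes {1..n} \<and> cycle_type n p = L}"

definition class_data :: "nat \<Rightarrow> nat multiset \<Rightarrow> real" where
  "class_data n L = real (card (cycle_type_class n L))"

lemma finite_partitions: "finite (partitions n)"
proof (rule finite_subset)
  show "partitions n \<subseteq> mset ` {xs. set xs \<subseteq> {..n} \<and> length xs \<le> n}"
  proof
    fix L assume L: "L \<in> partitions n"
    obtain xs where xs: "mset xs = L" using ex_mset by blast
    have sum: "sum_list xs = n" and pos: "\<forall>k\<in>set xs. 0 < k"
      using L xs by (auto simp: partitions_def sum_mset_sum_list[symmetric])
    have "length xs \<le> sum_list xs"
      using pos by (induction xs) auto
    moreover have "set xs \<subseteq> {..n}"
      using sum member_le_sum_list by auto
    ultimately show "L \<in> mset ` {xs. set xs \<subseteq> {..n} \<and> length xs \<le> n}"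
      using xs sum by blast
  qed
  show "finite (mset ` {xs. set xs \<subseteq> {..n} \<and> length xs \<le> n})"
    by (intro finite_imageI finite_lists_length_le) auto
qed

lemma card_partitions_at_top: "filterlim (\<lambda>n. card (partitions n)) at_top sequentially"
proof (rule filterlim_at_top_mono)
  show "filterlim (\<lambda>n::nat. n - 1) at_top sequentially"
    by (rule filterlim_minus_const_nat_at_top)
  have "n - 1 \<le> card (partitions n)" for n
  proof -
    define f where "f k = add_mset k (replicate_mset (n - k) (1::nat))" for k
    have "inj_on f {2..n}"
    proof (rule inj_onI)
      fix j k assume jk: "j \<in> {2..n}" "k \<in> {2..n}" "f j = f k"
      have "size (f i) = Suc (n - i)" for i by (simp add: f_def)
      then have "n - j = n - k" using jk(3) by (metis Suc_inject)
      with jk(1,2) show "j = k" by auto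
    qed
    then have "card (f ` {2..n}) = n - 1" by (simp add: card_image)
    moreover have "f ` {2..n} \<subseteq> partitions n"
      by (auto simp: f_def partitions_def sum_mset_replicate_mset split: if_splits)
    ultimately show ?thesis using card_mono[OF finite_partitions] by metis
  qed
  then show "\<forall>\<^sub>F n in sequentially. n - 1 \<le> card (partitions n)" by simp
qed

end

theory Submission
  imports Defs "HOL-Real_Asymp.Real_Asymp"
begin

text \<open>
  Write \<open>p n\<close> for the number of partitions of \<open>n\<close> and \<open>c\<close> for the vector of class sizes. The
  classes partition \<open>S\<^sub>n\<close>, so \<open>(c, 1) = n!\<close>, and \<open>\<parallel>1\<parallel> = sqrt (p n)\<close>. Everything else follows from
  crude bounds on \<open>p n\<close> and \<open>\<parallel>c\<parallel>\<close>.

  Cauchy-Schwarz and \<open>\<parallel>c\<parallel> \<le> (c, 1)\<close> confine the denominator of the log ratio to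
  \<open>n! \<le> \<parallel>c\<parallel> \<parallel>1\<parallel> \<le> n! sqrt (p n)\<close>. As \<open>p n \<le> 2 ^ n\<close> (there are at most \<open>2 ^ n\<close> compositions), the
  two ends have logarithms differing by \<open>O(n)\<close>, which is negligible against
  \<open>ln n! \<ge> n ln n - n\<close>; so the log ratio tends to 1.

  For the angle, a single coordinate of \<open>c\<close> is already large: there are at least \<open>(n - 1)!\<close>
  cycles of length \<open>n\<close>. Hence the cosine is at most \<open>n! / ((n - 1)! sqrt (p n)) = n / sqrt (p n)\<close>,
  which tends to 0 because \<open>p n\<close> grows at least cubically, already for partitions with parts in
  \<open>{1, 2, 3, 4}\<close>.
\<close>

section \<open>Class sizes add up to the order of the group\<close>

text \<open>The orbits of a permutation are disjoint and cover its domain, so their sizes sum to \<open>n\<close>.\<close>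

lemma cycle_type_in_partitions:
  assumes p: "p permutes {1..n}"
  shows "cycle_type n p \<in> partitions n"
proof -
  have perm: "permutation p"
    using p permutation_permutes by blast
  have fin: "finite A" if "A \<in> orbit p ` {1..n}" for A
    using that finite_orbit[OF permutation_self_in_orbit[OF perm]] by auto
  have union: "\<Union>(orbit p ` {1..n}) = {1..n}"
    using permutes_orbit_subset[OF p] permutation_self_in_orbit[OF perm] by blast
  have "pairwise disjnt (orbit p ` {1..n})"
  proof (clarsimp simp: pairwise_def disjnt_iff)
    fix i j z assume ne: "orbit p i \<noteq> orbit p j" and z: "z \<in> orbit p i" "z \<in> orbit p j"
    have "orbit p z = orbit p i" "orbit p z = orbit p j"
      using orbit_cyclic_eq3 cyclic_on_orbit'[OF perm] z by metis+
    with ne show False by simp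
  qed
  then have "(\<Sum>A\<in>orbit p ` {1..n}. card A) = n"
    using card_Union_disjoint[of "orbit p ` {1..n}"] fin union by simp
  moreover have "0 < card (orbit p i)" if "i \<in> {1..n}" for i
    using fin that orbit_nonempty[of p i] by (simp add: card_gt_0_iff)
  ultimately show ?thesis
    by (auto simp: partitions_def cycle_type_def sum_unfold_sum_mset)
qed

lemma sum_class_data: "(\<Sum>L\<in>partitions n. class_data n L) = fact n"
proof -
  let ?P = "{p. p permutes {1..n}}"
  have fin: "finite ?P" by (simp add: finite_permutations)
  have "(\<Sum>L\<in>partitions n. card {p\<in>?P. cycle_type n p = L}) = card ?P"
    using sum_fun_comp[OF fin finite_partitions, of "cycle_type n" n "\<lambda>_. 1::nat"]
      cycle_type_in_partitions by (simp add: image_subset_iff)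
  also have "card ?P = fact n"
    by (rule card_permutations) auto
  finally have "real (\<Sum>L\<in>partitions n. card {p\<in>?P. cycle_type n p = L}) = fact n"
    by simp
  then show ?thesis
    by (simp add: class_data_def cycle_type_class_def)
qed

section \<open>The class of full cycles\<close>

lemma cycle_type_cyclic:
  assumes "cyclic_on p {1..n}"
  shows "cycle_type n p = {#n#}"
proof -
  have "orbit p ` {1..n} = {{1..n}}"
    using assms unfolding cyclic_on_alldef by (auto simp: image_iff)
  then show ?thesis by (simp add: cycle_type_def)
qed

lemma ex_full_cycle:
  fixes n :: nat
  assumes "0 < n"
  obtains c where "c permutes {1..n}" "cyclic_on c {1..n}"
proof -
  define c where "c i = (if i \<in> {1..<n} then Suc i else if i = n then 1 else i)" for i
  have c: "c permutes {1..n}"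
  proof (rule inj_imp_permutes)
    show "inj_on c {1..n}"
      by (auto simp: inj_on_def c_def)
  qed (use assms in \<open>auto simp: c_def\<close>)
  have perm: "permutation c"
    using c permutation_permutes by blast
  have pow: "k < n \<Longrightarrow> (c ^^ k) 1 = Suc k" for k
    by (induction k) (auto simp: c_def)
  have "i \<in> orbit c 1" if i: "i \<in> {1..n}" for i
  proof -
    have "i - 1 < n" using i assms by auto
    then have "i = (c ^^ (i - 1)) 1"
      using pow[of "i - 1"] i by simp
    then show ?thesis
      unfolding orbit_altdef_permutation[OF perm] by blast
  qed
  with permutes_orbit_subset[OF c, of 1] have "{1..n} = orbit c 1"
    using assms by auto
  then have "cyclic_on c {1..n}"
    using assms by (intro cyclic_on_singleI[of 1]) auto
  with c show thesis by (rule that)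
qed

text \<open>
  Conjugating an \<open>n\<close>-cycle \<open>c\<close> by a permutation \<open>s\<close> gives an \<open>n\<close>-cycle that sends \<open>s x\<close> to
  \<open>s (c x)\<close>. If \<open>s\<close> fixes 1, it can be read off from this conjugate by following the orbit of 1,
  so the \<open>(n - 1)!\<close> such \<open>s\<close> produce distinct \<open>n\<close>-cycles.
\<close>

lemma fact_le_class_data_full_cycles:
  assumes n: "0 < n"
  shows "fact (n - 1) \<le> class_data n {#n#}"
proof -
  obtain c where c: "c permutes {1..n}" "cyclic_on c {1..n}"
    using ex_full_cycle[OF n] .
  define conj where "conj s = s \<circ> c \<circ> inv s" for s :: "nat \<Rightarrow> nat"
  let ?S = "{s. s permutes {2..n}}"
  have perm: "s permutes {1..n}" if "s \<in> ?S" for s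
    using that permutes_subset[of s "{2..n}" "{1..n}"] by auto
  have conj: "conj s (s x) = s (c x)" if "s \<in> ?S" for s x
    using permutes_inverses(2)[OF perm[OF that]] by (simp add: conj_def)
  have "conj ` ?S \<subseteq> cycle_type_class n {#n#}"
  proof
    fix q assume "q \<in> conj ` ?S"
    then obtain s where s: "s \<in> ?S" and q: "q = conj s" by blast
    have "q permutes {1..n}"
      unfolding q conj_def using perm[OF s] c(1)
      by (intro permutes_compose permutes_inv)
    moreover have "cyclic_on q (s ` {1..n})"
      using c(2) conj[OF s] by (intro cyclic_on_image) (auto simp: q)
    then have "cyclic_on q {1..n}"
      using permutes_image[OF perm[OF s]] by simp
    ultimately show "q \<in> cycle_type_class n {#n#}"
      by (simp add: cycle_type_class_def cycle_type_cyclic)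
  qed
  moreover have "inj_on conj ?S"
  proof (rule inj_onI)
    fix s t assume st: "s \<in> ?S" "t \<in> ?S" and eq: "conj s = conj t"
    have fix1: "s 1 = 1" "t 1 = 1"
      using st by (auto simp: permutes_def)
    have follow: "s (c x) = t (c x)" if "s x = t x" for x
      using conj[OF st(1), of x] conj[OF st(2), of x] eq that by simp
    have "s x = t x" if "x \<in> orbit c 1" for x
      using that
    proof induction
      case base
      show ?case using follow[of 1] fix1 by simp
    next
      case (step y)
      then show ?case using follow by blast
    qed
    moreover have "orbit c 1 = {1..n}"
      using orbit_cyclic_eq3[OF c(2)] n by simp
    moreover have "s x = t x" if "x \<notin> {1..n}" for x
      using perm[OF st(1)] perm[OF st(2)] that by (simp add: permutes_not_in)
    ultimately show "s = t" by blast
  qed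
  moreover have "finite (cycle_type_class n {#n#})"
    by (rule finite_subset[OF _ finite_permutations[of "{1..n}"]])
       (auto simp: cycle_type_class_def)
  ultimately have "card ?S \<le> card (cycle_type_class n {#n#})"
    using card_inj_on_le by blast
  moreover have "card ?S = fact (n - 1)"
    by (rule card_permutations) auto
  ultimately have "real (fact (n - 1)) \<le> real (card (cycle_type_class n {#n#}))"
    by linarith
  then show ?thesis by (simp add: class_data_def)
qed

section \<open>Growth of partition numbers and factorials\<close>

definition compositions :: "nat \<Rightarrow> nat list set" where
  "compositions n = {xs. (\<forall>k\<in>set xs. 0 < k) \<and> sum_list xs = n}"

text \<open>
  A composition of \<open>Suc n\<close> either starts with 1, which can be dropped, or its first entry can be
  decreased by one; both operations leave a composition of \<open>n\<close>.
\<close>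

lemma card_compositions_le: "finite (compositions n) \<and> card (compositions n) \<le> 2 ^ n"
proof (induction n)
  case 0
  have "compositions 0 = {[]}"
    by (auto simp: compositions_def) (metis list.set_sel(1) not_less_zero)
  then show ?case by simp
next
  case (Suc n)
  define incr where "incr xs = Suc (hd xs) # tl xs" for xs :: "nat list"
  have sub: "compositions (Suc n) \<subseteq> (#) 1 ` compositions n \<union> incr ` compositions n"
  proof
    fix xs assume xs: "xs \<in> compositions (Suc n)"
    then obtain k ys where eq: "xs = Suc k # ys"
      by (cases xs; cases "hd xs") (auto simp: compositions_def)
    show "xs \<in> (#) 1 ` compositions n \<union> incr ` compositions n"
    proof (cases k)
      case 0
      then show ?thesis using xs eq by (auto simp: compositions_def)
    next
      case (Suc j)
      then have "k # ys \<in> compositions n" "xs = incr (k # ys)"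
        using xs eq by (auto simp: compositions_def incr_def)
      then show ?thesis by blast
    qed
  qed
  have "card (compositions (Suc n)) \<le> card ((#) 1 ` compositions n \<union> incr ` compositions n)"
    using Suc by (intro card_mono sub) auto
  also have "\<dots> \<le> card ((#) 1 ` compositions n) + card (incr ` compositions n)"
    by (rule card_Un_le)
  also have "\<dots> \<le> card (compositions n) + card (compositions n)"
    using Suc by (intro add_mono card_image_le) auto
  also have "\<dots> \<le> 2 ^ Suc n"
    using Suc by simp
  finally show ?case
    using finite_subset[OF sub] Suc by blast
qed

lemma card_partitions_le: "card (partitions n) \<le> 2 ^ n"
proof -
  have "partitions n \<subseteq> mset ` compositions n"
  proof
    fix L assume L: "L \<in> partitions n"
    obtain xs where xs: "mset xs = L" using ex_mset by blast
    with L have "xs \<in> compositions n"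
      by (auto simp: partitions_def compositions_def sum_mset_sum_list[symmetric])
    with xs show "L \<in> mset ` compositions n" by blast
  qed
  then have "card (partitions n) \<le> card (compositions n)"
    using card_compositions_le surj_card_le by blast
  then show ?thesis
    using card_compositions_le le_trans by blast
qed

text \<open>
  Any numbers \<open>a\<close>, \<open>b\<close>, \<open>c\<close> of parts equal to 2, 3, 4, each at most \<open>n div 9\<close>, can be completed by
  parts equal to 1, since \<open>2 + 3 + 4 = 9\<close>.
\<close>

lemma card_partitions_ge: "Suc (n div 9) ^ 3 \<le> card (partitions n)"
proof -
  define f where "f = (\<lambda>(a, b, c). replicate_mset a 2 + replicate_mset b 3 + replicate_mset c 4
    + replicate_mset (n - (2 * a + 3 * b + 4 * c)) (1::nat))"
  let ?B = "{..n div 9} \<times> {..n div 9} \<times> {..n div 9}"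
  have "inj_on f ?B"
  proof (rule inj_onI)
    fix x y assume eq: "f x = f y"
    obtain a b c a' b' c' where xy: "x = (a, b, c)" "y = (a', b', c')"
      by (cases x, cases y) auto
    have "count (f x) k = count (f y) k" for k by (simp add: eq)
    from this[of 2] this[of 3] this[of 4] show "x = y"
      by (simp add: xy f_def)
  qed
  moreover have "f ` ?B \<subseteq> partitions n"
  proof
    fix L assume "L \<in> f ` ?B"
    then obtain a b c where L: "L = f (a, b, c)"
      and abc: "a \<le> n div 9" "b \<le> n div 9" "c \<le> n div 9" by auto
    have "2 * a + 3 * b + 4 * c \<le> n" using abc by linarith
    then show "L \<in> partitions n"
      by (auto simp: L f_def partitions_def sum_mset_replicate_mset split: if_splits)
  qed
  ultimately have "card ?B \<le> card (partitions n)"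
    using card_inj_on_le finite_partitions by blast
  then show ?thesis by (simp add: power3_eq_cube card_cartesian_product mult.assoc del: mult_Suc mult_Suc_right)
qed

lemma card_partitions_ge_cubic: "(real n / 9) ^ 3 \<le> real (card (partitions n))"
proof -
  have "real n / 9 \<le> real (Suc (n div 9))"
  proof -
    have "n \<le> 9 * Suc (n div 9)"
      using dividend_less_div_times[of 9 n] by simp
    then show ?thesis by linarith
  qed
  then have "(real n / 9) ^ 3 \<le> real (Suc (n div 9)) ^ 3"
    by (intro power_mono) auto
  also have "\<dots> \<le> real (card (partitions n))"
    using card_partitions_ge[of n] by (metis of_nat_le_iff of_nat_power)
  finally show ?thesis .
qed

text \<open>The term \<open>n ^ n / n!\<close> is one summand of the exponential series of \<open>exp n\<close>.\<close>

lemma ln_fact_ge: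
  assumes "0 < n"
  shows "real n * ln (real n) - real n \<le> ln (fact n)"
proof -
  have "real n ^ n /\<^sub>R fact n \<le> exp (real n)"
    unfolding exp_def
    using sum_le_suminf[OF summable_exp_generic, of "{n}" "real n"] by simp
  then have "real n ^ n \<le> exp (real n) * fact n"
    by (simp add: field_simps)
  then have "ln (real n ^ n) \<le> ln (exp (real n) * fact n)"
    using assms by (subst ln_le_cancel_iff) auto
  then show ?thesis
    using assms by (simp add: ln_mult ln_realpow)
qed

section \<open>Comparison with the constant vector\<close>

lemma inner_class_data_one: "inner_on (partitions n) (class_data n) (\<lambda>_. 1) = fact n"
  by (simp add: inner_on_def sum_class_data)

lemma L2_set_one: "L2_set (\<lambda>_. 1) I = sqrt (real (card I))"
  by (simp add: L2_set_def)

lemma fact_le_norms: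
  "fact n \<le> L2_set (class_data n) (partitions n) * sqrt (card (partitions n))"
  using L2_set_mult_ineq[of "class_data n" "\<lambda>_. 1" "partitions n"] sum_class_data[of n]
  by (simp add: L2_set_one class_data_def)

lemma norms_pos: "0 < L2_set (class_data n) (partitions n) * sqrt (card (partitions n))"
  using fact_le_norms[of n] fact_gt_zero by (rule less_le_trans[rotated])

lemma L2_set_class_data_le: "L2_set (class_data n) (partitions n) \<le> fact n"
  using L2_set_le_sum[of "partitions n" "class_data n"] sum_class_data[of n]
  by (simp add: class_data_def)

lemma ln_norms_le:
  "ln (L2_set (class_data n) (partitions n) * sqrt (card (partitions n)))
     \<le> ln (fact n) + real n * ln 2 / 2"
proof -
  let ?p = "real (card (partitions n))"
  have "L2_set (class_data n) (partitions n) * sqrt ?p \<le> fact n * sqrt (2 ^ n)"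
    using L2_set_class_data_le[of n] card_partitions_le[of n]
    by (intro mult_mono) (auto simp: L2_set_nonneg simp flip: of_nat_le_iff)
  then have "ln (L2_set (class_data n) (partitions n) * sqrt ?p) \<le> ln (fact n * sqrt (2 ^ n))"
    using norms_pos[of n] by (subst ln_le_cancel_iff) auto
  also have "\<dots> = ln (fact n) + real n * ln 2 / 2"
    by (simp add: ln_mult ln_sqrt ln_realpow)
  finally show ?thesis .
qed

lemma class_data_asymptotically_log_constant: "asymptotically_log_constant partitions class_data"
proof -
  define N where "N n = L2_set (class_data n) (partitions n) * sqrt (card (partitions n))" for n
  have "(\<lambda>n. ln (fact n) / ln (N n)) \<longlonglongrightarrow> 1"
  proof (rule tendsto_sandwich)
    show "(\<lambda>n. 1 - (real n * ln 2 / 2) / (real n * ln (real n) - real n)) \<longlonglongrightarrow> 1"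
      by real_asymp
    have bounds: "1 - (real n * ln 2 / 2) / (real n * ln (real n) - real n) \<le> ln (fact n) / ln (N n)
        \<and> ln (fact n) / ln (N n) \<le> 1"
      if pos: "0 < real n * ln (real n) - real n" for n
    proof -
      define a b where "a = ln (fact n :: real)" and "b = real n * ln 2 / 2"
      have "0 < n" using pos by (cases n) auto
      have ge: "real n * ln (real n) - real n \<le> a"
        unfolding a_def using ln_fact_ge[OF \<open>0 < n\<close>] .
      have a: "0 < a" using pos ge by linarith
      have b: "0 \<le> b" by (simp add: b_def)
      have lower: "a \<le> ln (N n)"
        unfolding a_def N_def using fact_le_norms[of n] norms_pos[of n]
        by (subst ln_le_cancel_iff) auto
      have upper: "ln (N n) \<le> a + b"
        unfolding a_def b_def N_def by (rule ln_norms_le)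
      have "1 - b / (real n * ln (real n) - real n) \<le> 1 - b / a"
        using pos ge b by (simp add: frac_le)
      also have "\<dots> \<le> a / (a + b)"
        using a b by (simp add: field_simps)
      also have "\<dots> \<le> a / ln (N n)"
        using a b lower upper by (intro divide_left_mono) auto
      finally have "1 - b / (real n * ln (real n) - real n) \<le> a / ln (N n)" .
      moreover have "a / ln (N n) \<le> 1"
        using a lower by simp
      ultimately show ?thesis
        unfolding a_def b_def by blast
    qed
    have ev: "\<forall>\<^sub>F n in sequentially. 0 < real n * ln (real n) - real n"
      by real_asymp
    show "\<forall>\<^sub>F n in sequentially.
        1 - (real n * ln 2 / 2) / (real n * ln (real n) - real n) \<le> ln (fact n) / ln (N n)"
      and "\<forall>\<^sub>F n in sequentially. ln (fact n) / ln (N n) \<le> 1"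
      using ev by (eventually_elim, use bounds in blast)+
  qed simp
  then show ?thesis
    by (simp add: asymptotically_log_constant_def inner_class_data_one L2_set_one N_def)
qed

lemma cosine_class_data_tendsto_0:
  "(\<lambda>n. inner_on (partitions n) (class_data n) (\<lambda>_. 1) /
       (L2_set (class_data n) (partitions n) * L2_set (\<lambda>_. 1) (partitions n))) \<longlonglongrightarrow> 0"
proof (rule tendsto_sandwich[where f = "\<lambda>_. 0"])
  show "(\<lambda>n. real n / sqrt ((real n / 9) ^ 3)) \<longlonglongrightarrow> 0"
    by real_asymp
  have "inner_on (partitions n) (class_data n) (\<lambda>_. 1) /
      (L2_set (class_data n) (partitions n) * L2_set (\<lambda>_. 1) (partitions n))
      \<le> real n / sqrt ((real n / 9) ^ 3)" if n: "0 < n" for n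
  proof -
    have "{#n#} \<in> partitions n" using n by (simp add: partitions_def)
    then have "fact (n - 1) \<le> L2_set (class_data n) (partitions n)"
      using fact_le_class_data_full_cycles[OF n]
        member_le_L2_set[OF finite_partitions, of "{#n#}" n "class_data n"] by linarith
    then have "fact (n - 1) * sqrt ((real n / 9) ^ 3)
        \<le> L2_set (class_data n) (partitions n) * sqrt (card (partitions n))"
      by (intro mult_mono real_sqrt_le_mono card_partitions_ge_cubic) auto
    then have "fact n / (L2_set (class_data n) (partitions n) * sqrt (card (partitions n)))
        \<le> fact n / (fact (n - 1) * sqrt ((real n / 9) ^ 3))"
      by (intro divide_left_mono) (use n norms_pos[of n] in \<open>auto intro!: mult_pos_pos\<close>)
    also have "\<dots> = real n / sqrt ((real n / 9) ^ 3)"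
      using n by (simp add: fact_reduce[of n])
    finally show ?thesis
      by (simp add: inner_class_data_one L2_set_one)
  qed
  then show "\<forall>\<^sub>F n in sequentially. inner_on (partitions n) (class_data n) (\<lambda>_. 1) /
      (L2_set (class_data n) (partitions n) * L2_set (\<lambda>_. 1) (partitions n))
      \<le> real n / sqrt ((real n / 9) ^ 3)"
    by (intro eventually_mono[OF eventually_gt_at_top[of 0]])
  show "\<forall>\<^sub>F n in sequentially. 0 \<le> inner_on (partitions n) (class_data n) (\<lambda>_. 1) /
      (L2_set (class_data n) (partitions n) * L2_set (\<lambda>_. 1) (partitions n))"
    by (simp add: inner_class_data_one L2_set_nonneg)
qed simp

theorem theorem10p2:
  shows "asymptotically_log_constant partitions class_data \<and>
         (\<lambda>n. angle_on (partitions n) (class_data n) (\<lambda>_. 1)) \<longlonglongrightarrow> pi / 2 \<and>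
         \<not> asymptotically_constant partitions class_data"
proof (intro conjI)
  show "asymptotically_log_constant partitions class_data"
    by (rule class_data_asymptotically_log_constant)
  have "isCont arccos 0" by (rule isCont_arccos) auto
  then show "(\<lambda>n. angle_on (partitions n) (class_data n) (\<lambda>_. 1)) \<longlonglongrightarrow> pi / 2"
    unfolding angle_on_def
    using isCont_tendsto_compose[OF _ cosine_class_data_tendsto_0, of arccos] by simp
  show "\<not> asymptotically_constant partitions class_data"
    unfolding asymptotically_constant_def
    using LIMSEQ_unique[OF cosine_class_data_tendsto_0] zero_neq_one by blast
qed

end
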